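(* Let $T$ be a $\Sigma$-formula and let $A(x)$ be an arbitrary formula, where $x$ is not free in $T$. Then the formula $$\forall x\,\bigl((A(x)\Rightarrow T)\Rightarrow T\bigr)\Rightarrow\bigl(\forall x\,A(x)\Rightarrow T\bigr)\Rightarrow T$$ is derivable in $\mathrm{MQC}^+$ (with annotation formula $T$) from the empty context, without annotation on the final sequent; that is, $\vdash^+\forall x((A(x)\Rightarrow T)\Rightarrow T)\Rightarrow(\forall x A(x)\Rightarrow T)\Rightarrow T$.
   Context: Formulas are those of first-order predicate logic, built from atomic formulas with $\wedge,\vee,\Rightarrow,\exists,\forall$. A $\Sigma$-formula is a formula containing neither $\Rightarrow$ nor $\forall$. Implication associates to the right. The system $\mathrm{MQC}^+$. Only one formula, a $\Sigma$-formula $T$ fixed once and for all, may occur as an annotation in a derivation. Sequents have the form $\Gamma\vdash_\diamond A$, where $\Gamma$ is a finite context of formulas, and $\diamond$ is either the annotation $T$ (written $\Gamma\vdash_T A$) or absent (written $\Gamma\vdash A$). In the rules below, apart from reset and shift, $\diamond$ is the same in all premises and in the conclusion: - Ax: $\Gamma\vdash_\diamond A$ if $A\in\Gamma$. - $\wedge_I$: from $\Gamma\vdash_\diamond A_1$ and $\Gamma\vdash_\diamond A_2$ infer $\Gamma\vdash_\diamond A_1\wedge A_2$. $\wedge_E^i$ ($i=1,2$): from $\Gamma\vdash_\diamond A_1\wedge A_2$ infer $\Gamma\vdash_\diamond A_i$. - $\vee_I^i$: from $\Gamma\vdash_\diamond A_i$ infer $\Gamma\vdash_\diamond A_1\vee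 A_2$. $\vee_E$: from $\Gamma\vdash_\diamond A_1\vee A_2$, $\Gamma,A_1\vdash_\diamond C$ and $\Gamma,A_2\vdash_\diamond C$ infer $\Gamma\vdash_\diamond C$. - $\Rightarrow_I$: from $\Gamma,A_1\vdash_\diamond A_2$ infer $\Gamma\vdash_\diamond A_1\Rightarrow A_2$. $\Rightarrow_E$: from $\Gamma\vdash_\diamond A_1\Rightarrow A_2$ and $\Gamma\vdash_\diamond A_1$ infer $\Gamma\vdash_\diamond A_2$. - $\forall_I$: from $\Gamma\vdash_\diamond A(x)$ with $x$ fresh infer $\Gamma\vdash_\diamond\forall x A(x)$. $\forall_E$: from $\Gamma\vdash_\diamond\forall xA(x)$ infer $\Gamma\vdash_\diamond A(t)$. - $\exists_I$: from $\Gamma\vdash_\diamond A(t)$ infer $\Gamma\vdash_\diamond\exists xA(x)$. $\exists_E$: from $\Gamma\vdash_\diamond\exists xA(x)$ and $\Gamma,A(x)\vdash_\diamond C$ with $x$ fresh infer $\Gamma\vdash_\diamond C$. - Reset ($\#$): from $\Gamma\vdash_T T$ infer $\Gamma\vdash_\diamond T$ (with $\diamond$ either $T$ or absent). - Shift ($\mathcal S$): from $\Gamma,A\Rightarrow T\vdash_T T$ infer $\Gamma\vdash_T A$. "$x$ fresh" means $x$ is not free in $\Gamma$, in $T$, or (for $\exists_E$) in $C$; the free variables of $T$, if any, are treated as parameters. $\Gamma\vdash^+A$ means that the unannotated sequent $\Gamma\vdash A$ is derivable. *)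

theory Defs
  imports Main
begin

text \<open>
  Function and predicate symbols carry no arity: a symbol applied to argument lists of different
  lengths acts as a different symbol for each length. Constants and propositional atoms (such as
  falsity, which is not a separate connective) are symbols applied to the empty list.
\<close>

datatype 'f tm = Var nat | Fn 'f "'f tm list"

datatype ('f, 'p) fm =
    Atom 'p "'f tm list"
  | And "('f, 'p) fm" "('f, 'p) fm"  (infixr "\<^bold>\<and>" 65)
  | Or "('f, 'p) fm" "('f, 'p) fm"  (infixr "\<^bold>\<or>" 64)
  | Imp "('f, 'p) fm" "('f, 'p) fm"  (infixr "\<^bold>\<Rightarrow>" 63)
  | Exists nat "('f, 'p) fm"
  | Forall nat "('f, 'p) fm"

primrec fv_tm :: "'f tm \<Rightarrow> nat set" where
  "fv_tm (Var x) = {x}"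
| "fv_tm (Fn f ts) = \<Union> (set (map fv_tm ts))"

primrec fv :: "('f, 'p) fm \<Rightarrow> nat set" where
  "fv (Atom p ts) = (\<Union>t\<in>set ts. fv_tm t)"
| "fv (A \<^bold>\<and> B) = fv A \<union> fv B"
| "fv (A \<^bold>\<or> B) = fv A \<union> fv B"
| "fv (A \<^bold>\<Rightarrow> B) = fv A \<union> fv B"
| "fv (Exists x A) = fv A - {x}"
| "fv (Forall x A) = fv A - {x}"

primrec is_Sigma :: "('f, 'p) fm \<Rightarrow> bool" where
  "is_Sigma (Atom p ts) = True"
| "is_Sigma (A \<^bold>\<and> B) = (is_Sigma A \<and> is_Sigma B)"
| "is_Sigma (A \<^bold>\<or> B) = (is_Sigma A \<and> is_Sigma B)"
| "is_Sigma (A \<^bold>\<Rightarrow> B) = False"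
| "is_Sigma (Exists x A) = is_Sigma A"
| "is_Sigma (Forall x A) = False"

primrec subst_tm :: "(nat \<Rightarrow> 'f tm) \<Rightarrow> 'f tm \<Rightarrow> 'f tm" where
  "subst_tm \<sigma> (Var x) = \<sigma> x"
| "subst_tm \<sigma> (Fn f ts) = Fn f (map (subst_tm \<sigma>) ts)"

text \<open>
  The name that a binder of \<open>x\<close> with body \<open>A\<close> receives when \<open>\<sigma>\<close> is applied beneath it: \<open>x\<close>
  itself if it captures nothing, otherwise the least variable that captures nothing.
\<close>

definition bound_name :: "(nat \<Rightarrow> 'f tm) \<Rightarrow> nat \<Rightarrow> ('f, 'p) fm \<Rightarrow> nat" where
  "bound_name \<sigma> x A =
     (let V = (\<Union>z\<in>fv A - {x}. fv_tm (\<sigma> z)) in if x \<in> V then LEAST y. y \<notin> V else x)"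

primrec subst :: "(nat \<Rightarrow> 'f tm) \<Rightarrow> ('f, 'p) fm \<Rightarrow> ('f, 'p) fm" where
  "subst \<sigma> (Atom p ts) = Atom p (map (subst_tm \<sigma>) ts)"
| "subst \<sigma> (A \<^bold>\<and> B) = (subst \<sigma> A \<^bold>\<and> subst \<sigma> B)"
| "subst \<sigma> (A \<^bold>\<or> B) = (subst \<sigma> A \<^bold>\<or> subst \<sigma> B)"
| "subst \<sigma> (A \<^bold>\<Rightarrow> B) = (subst \<sigma> A \<^bold>\<Rightarrow> subst \<sigma> B)"
| "subst \<sigma> (Exists x A) =
     Exists (bound_name \<sigma> x A) (subst (\<sigma>(x := Var (bound_name \<sigma> x A))) A)"
| "subst \<sigma> (Forall x A) =
     Forall (bound_name \<sigma> x A) (subst (\<sigma>(x := Var (bound_name \<sigma> x A))) A)"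

definition inst :: "('f, 'p) fm \<Rightarrow> nat \<Rightarrow> 'f tm \<Rightarrow> ('f, 'p) fm" where
  "inst A x t = subst (Var(x := t)) A"

datatype annotation = Absent | Annotated

text \<open>
  \<open>mqc T \<Gamma> d A\<close> is derivability of the sequent with context \<open>\<Gamma>\<close> and conclusion \<open>A\<close>, annotated
  by the fixed formula \<open>T\<close> if \<open>d = Annotated\<close> and not annotated if \<open>d = Absent\<close>.

  Formulas are concrete syntax and not identified up to renaming of bound variables, so the
  eigenvariable \<open>y\<close> in \<open>AllI\<close> and \<open>ExE\<close> may differ from the bound variable \<open>x\<close>; the condition
  that \<open>y\<close> is not free in the quantified formula still permits \<open>y = x\<close>. Eigenvariables avoid
  \<open>T\<close> in both kinds of sequents.
\<close>

inductive mqc ::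
  "('f, 'p) fm \<Rightarrow> ('f, 'p) fm list \<Rightarrow> annotation \<Rightarrow> ('f, 'p) fm \<Rightarrow> bool"
  for T :: "('f, 'p) fm" where
  Ax: "A \<in> set \<Gamma> \<Longrightarrow> mqc T \<Gamma> d A"
| AndI: "mqc T \<Gamma> d A \<Longrightarrow> mqc T \<Gamma> d B \<Longrightarrow> mqc T \<Gamma> d (A \<^bold>\<and> B)"
| AndE1: "mqc T \<Gamma> d (A \<^bold>\<and> B) \<Longrightarrow> mqc T \<Gamma> d A"
| AndE2: "mqc T \<Gamma> d (A \<^bold>\<and> B) \<Longrightarrow> mqc T \<Gamma> d B"
| OrI1: "mqc T \<Gamma> d A \<Longrightarrow> mqc T \<Gamma> d (A \<^bold>\<or> B)"
| OrI2: "mqc T \<Gamma> d B \<Longrightarrow> mqc T \<Gamma> d (A \<^bold>\<or> B)"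
| OrE: "mqc T \<Gamma> d (A \<^bold>\<or> B) \<Longrightarrow> mqc T (A # \<Gamma>) d C \<Longrightarrow> mqc T (B # \<Gamma>) d C \<Longrightarrow> mqc T \<Gamma> d C"
| ImpI: "mqc T (A # \<Gamma>) d B \<Longrightarrow> mqc T \<Gamma> d (A \<^bold>\<Rightarrow> B)"
| ImpE: "mqc T \<Gamma> d (A \<^bold>\<Rightarrow> B) \<Longrightarrow> mqc T \<Gamma> d A \<Longrightarrow> mqc T \<Gamma> d B"
| AllI: "mqc T \<Gamma> d (inst A x (Var y)) \<Longrightarrow> y \<notin> (\<Union>B\<in>set \<Gamma>. fv B) \<Longrightarrow> y \<notin> fv T \<Longrightarrow>
    y \<notin> fv (Forall x A) \<Longrightarrow> mqc T \<Gamma> d (Forall x A)"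
| AllE: "mqc T \<Gamma> d (Forall x A) \<Longrightarrow> mqc T \<Gamma> d (inst A x t)"
| ExI: "mqc T \<Gamma> d (inst A x t) \<Longrightarrow> mqc T \<Gamma> d (Exists x A)"
| ExE: "mqc T \<Gamma> d (Exists x A) \<Longrightarrow> mqc T (inst A x (Var y) # \<Gamma>) d C \<Longrightarrow>
    y \<notin> (\<Union>B\<in>set \<Gamma>. fv B) \<Longrightarrow> y \<notin> fv T \<Longrightarrow> y \<notin> fv C \<Longrightarrow> y \<notin> fv (Exists x A) \<Longrightarrow> mqc T \<Gamma> d C"
| Reset: "mqc T \<Gamma> Annotated T \<Longrightarrow> mqc T \<Gamma> d T"
| Shift: "mqc T ((A \<^bold>\<Rightarrow> T) # \<Gamma>) Annotated T \<Longrightarrow> mqc T \<Gamma> Annotated A"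

definition derivable_plus ::
  "('f, 'p) fm \<Rightarrow> ('f, 'p) fm list \<Rightarrow> ('f, 'p) fm \<Rightarrow> bool" where
  "derivable_plus T \<Gamma> A \<longleftrightarrow> mqc T \<Gamma> Absent A"

end

(* Reset turns the annotation on, so that under the annotation it suffices to prove "Forall x A"
   from the hypothesis H = "Forall x ((A => T) => T)". With the bound variable x itself as
   eigenvariable, shift assumes "A => T" and asks for T, which H gives at x. *)
theory Submission
  imports Defs
begin

lemma subst_tm_Var [simp]: "subst_tm Var t = t"
  by (induction t) (simp_all add: map_idI)

text \<open>Since \<open>x\<close> is not in \<open>fv A - {x}\<close>, the identity substitution
  captures nothing and the binder keeps its name.\<close>

lemma bound_name_Var [simp]: "bound_name Var x A = x"
proof -
  have "(\<Union>z\<in>fv A - {x}. fv_tm (Var z)) = fv A - {x}"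
    by auto
  then show ?thesis
    by (simp add: bound_name_def)
qed

lemma subst_Var [simp]: "subst Var A = A"
  by (induction A) (simp_all add: map_idI)

text \<open>Allows \<open>x\<close> to be its own instance and eigenvariable, with no
  renaming.\<close>

lemma inst_Var_self [simp]: "inst A x (Var x) = A"
  by (simp add: inst_def)

theorem mainTheorem1:
  fixes T A :: "('f, 'p) fm" and x :: nat
  assumes "is_Sigma T"
    and "x \<notin> fv T"
  shows "derivable_plus T []
    (Forall x ((A \<^bold>\<Rightarrow> T) \<^bold>\<Rightarrow> T) \<^bold>\<Rightarrow> (Forall x A \<^bold>\<Rightarrow> T) \<^bold>\<Rightarrow> T)"
proof -
  let ?H = "Forall x ((A \<^bold>\<Rightarrow> T) \<^bold>\<Rightarrow> T)"
  let ?\<Gamma> = "[Forall x A \<^bold>\<Rightarrow> T, ?H]"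
  let ?\<Delta> = "(A \<^bold>\<Rightarrow> T) # ?\<Gamma>"
  have "mqc T ?\<Delta> Annotated ?H"
    by (rule mqc.Ax) simp
  then have "mqc T ?\<Delta> Annotated (inst ((A \<^bold>\<Rightarrow> T) \<^bold>\<Rightarrow> T) x (Var x))"
    by (rule mqc.AllE)
  then have "mqc T ?\<Delta> Annotated ((A \<^bold>\<Rightarrow> T) \<^bold>\<Rightarrow> T)"
    by simp
  moreover have "mqc T ?\<Delta> Annotated (A \<^bold>\<Rightarrow> T)"
    by (rule mqc.Ax) simp
  ultimately have "mqc T ?\<Delta> Annotated T"
    by (rule mqc.ImpE)
  then have "mqc T ?\<Gamma> Annotated A"
    by (rule mqc.Shift)
  \<comment> \<open>\<open>Shift\<close> has discharged the one hypothesis with \<open>A\<close>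
    unquantified; in \<open>?\<Gamma>\<close>, \<open>x\<close> could be free only through
    \<open>T\<close>, which \<open>assms(2)\<close> excludes.\<close>
  then have "mqc T ?\<Gamma> Annotated (Forall x A)"
    using assms(2) by (intro mqc.AllI[where y = x]) auto
  moreover have "mqc T ?\<Gamma> Annotated (Forall x A \<^bold>\<Rightarrow> T)"
    by (rule mqc.Ax) simp
  ultimately have "mqc T ?\<Gamma> Annotated T"
    by (blast intro: mqc.ImpE)
  then have "mqc T ?\<Gamma> Absent T"
    by (rule mqc.Reset)
  then show ?thesis
    unfolding derivable_plus_def by (intro mqc.ImpI)
qed

end
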